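(* Let $(X,d)$ be a metric space, $Y$ a real vector space, $K\subset Y$ a pointed convex cone specifying a partial order $\le_K$ on $Y$, and $H\subset K$ a nonempty $K$-convex set with $0\notin\mathrm{vcl}(H+K)$. Put $C_H:=H+K$. Let $f:X\to 2^Y$ be a set-valued map, $S$ a nonempty closed subset of $X$, $x_0\in S$, $\epsilon>0$, and let $\gamma>0$ be a constant. Suppose that the following conditions are satisfied: (i) $(X,d)$ is $(f,K)$-lower complete (or complete); (ii) $x_0\in AE(C_H,\epsilon)$; (iii) $f$ is $K$-slm and has $K_H$-$v_0$-closed values, where $v_0\in H+K$. Then there exists $\bar x\in S$ such that (a) $f(x_0)\subset f(\bar x)+\gamma\, d(x_0,\bar x)H+K$; (b) $f(\bar x)\not\subset f(x)+\gamma\, d(\bar x,x)H+K$ for all $x\in S\setminus\{\bar x\}$; (c) $d(x_0,\bar x)\le\epsilon/\gamma$.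
   Context: $2^Y$ is the family of all subsets of $Y$; for $A\subset X$, $f(A)=\bigcup_{x\in A}f(x)$. For $A,B\subset Y$ and $\alpha\in\mathbb R$, $A+B=\{a+b:a\in A,b\in B\}$ and $\alpha A=\{\alpha a:a\in A\}$. A cone is a nonempty set $K\subset Y$ with $\alpha K\subset K$ for all $\alpha\ge 0$; it is a convex cone if also $K+K\subset K$, and pointed if $K\cap(-K)=\{0\}$. Cones are always assumed nontrivial: $K\ne\{0\}$ and $K\ne Y$. The order is $y_1\le_K y_2\iff y_1-y_2\in -K$. A set $H$ is $K$-convex if $H+K$ is convex. For nonempty $A\subset Y$, the vector closure is $\mathrm{vcl}(A)=\{y\in Y:\exists v\in Y,\ \exists \lambda_n\ge 0,\ \lambda_n\to 0 \text{ with } y+\lambda_n v\in A\ \forall n\in\mathbb N\}$; for $v_0\in Y$, $\mathrm{vcl}_{v_0}(A)=\{y\in Y:\exists\lambda_n\ge 0,\ \lambda_n\to 0\text{ with }y+\lambda_n v_0\in A\ \forall n\in\mathbb N\}$, and $A$ is $v_0$-closed if $A=\mathrm{vcl}_{v_0}(A)$. $x_0\in AE(C_H,\epsilon)$ ($x_0$ is an $\epsilon$-efficient solution, in the sense of Németh with respect to $H$, of the problem of minimizing $f$ over $S$) means: $x_0\in S$ and there exists $y_0\in f(x_0)$ with $(f(S)-y_0)\cap(-\epsilon H-K)=\emptyset$. $f$ is $K$-slm ($K$-sequentially lower monotone) if for any sequence $(x_n)\subset X$ with $x_n\to\bar x\in X$ and $f(x_n)\subset f(x_{n+1})+K$ for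 all $n$, one has $f(x_n)\subset f(\bar x)+K$ for all $n$. $f$ has $K_H$-$v_0$-closed values if for any $x\in X$ and any $\alpha>0$, $f(x)+\alpha H+K$ is $v_0$-closed. $(X,d)$ is $(f,K)$-lower complete if every Cauchy sequence $(x_n)\subset X$ with $f(x_n)\subset f(x_{n+1})+K$ for all $n$ converges to some point of $X$. *)

theory Defs
  imports "HOL-Analysis.Analysis" "HOL-Library.Set_Algebras"
begin

text \<open>
  Set sums \<open>A + B\<close> are Minkowski sums, and \<open>(*\<^sub>R) \<alpha> ` A\<close> is the scaled set \<open>\<alpha>A\<close>.
  Set-valued maps \<open>f : X \<rightarrow> 2\<^sup>Y\<close> are functions \<open>'x \<Rightarrow> 'y set\<close>; empty values are allowed.
\<close>

text \<open>The library predicate \<open>cone\<close> holds for \<open>{}\<close>, hence the separate nonemptiness clause.\<close>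

definition nontrivial_cone :: "'y::real_vector set \<Rightarrow> bool" where
  "nontrivial_cone K \<longleftrightarrow> K \<noteq> {} \<and> cone K \<and> K \<noteq> {0} \<and> K \<noteq> UNIV"

definition pointed_convex_cone :: "'y::real_vector set \<Rightarrow> bool" where
  "pointed_convex_cone K \<longleftrightarrow>
     nontrivial_cone K \<and> K + K \<subseteq> K \<and> K \<inter> uminus ` K = {0}"

definition cone_convex :: "'y::real_vector set \<Rightarrow> 'y set \<Rightarrow> bool" where
  "cone_convex K H \<longleftrightarrow> convex (H + K)"

definition vcl :: "'y::real_vector set \<Rightarrow> 'y set" where
  "vcl A = {y. \<exists>v. \<exists>l :: nat \<Rightarrow> real.
     (\<forall>n. 0 \<le> l n) \<and> l \<longlonglongrightarrow> 0 \<and> (\<forall>n. y + l n *\<^sub>R v \<in> A)}"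

definition vcl_dir :: "'y::real_vector \<Rightarrow> 'y set \<Rightarrow> 'y set" where
  "vcl_dir v0 A = {y. \<exists>l :: nat \<Rightarrow> real.
     (\<forall>n. 0 \<le> l n) \<and> l \<longlonglongrightarrow> 0 \<and> (\<forall>n. y + l n *\<^sub>R v0 \<in> A)}"

definition dir_closed :: "'y::real_vector \<Rightarrow> 'y set \<Rightarrow> bool" where
  "dir_closed v0 A \<longleftrightarrow> A = vcl_dir v0 A"

text \<open>
  The \<open>\<epsilon>\<close>-efficient solutions, in the sense of Nemeth with respect to \<open>H\<close>, of minimizing
  \<open>f\<close> over \<open>S\<close> (usually written \<open>AE(C\<^sub>H, \<epsilon>)\<close> with \<open>C\<^sub>H = H + K\<close>).
\<close>

definition nemeth_efficient ::
  "('x \<Rightarrow> 'y::real_vector set) \<Rightarrow> 'x set \<Rightarrow> 'y set \<Rightarrow> 'y set \<Rightarrow> real \<Rightarrow> 'x set" where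
  "nemeth_efficient f S K H \<epsilon> =
     {x0 \<in> S. \<exists>y0\<in>f x0.
        (\<lambda>y. y - y0) ` (\<Union>x\<in>S. f x) \<inter> ((*\<^sub>R) (- \<epsilon>) ` H + uminus ` K) = {}}"

definition K_slm ::
  "'y::real_vector set \<Rightarrow> ('x::metric_space \<Rightarrow> 'y set) \<Rightarrow> bool" where
  "K_slm K f \<longleftrightarrow>
     (\<forall>(x :: nat \<Rightarrow> 'x) xbar.
        x \<longlonglongrightarrow> xbar \<and> (\<forall>n. f (x n) \<subseteq> f (x (Suc n)) + K) \<longrightarrow>
        (\<forall>n. f (x n) \<subseteq> f xbar + K))"

definition KH_dir_closed_values ::
  "'y::real_vector set \<Rightarrow> 'y set \<Rightarrow> 'y \<Rightarrow> ('x \<Rightarrow> 'y set) \<Rightarrow> bool" where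
  "KH_dir_closed_values K H v0 f \<longleftrightarrow>
     (\<forall>x. \<forall>\<alpha>>0. dir_closed v0 (f x + (*\<^sub>R) \<alpha> ` H + K))"

text \<open>Lower completeness of the whole metric space, given by the type \<open>'x\<close>.\<close>

definition lower_complete ::
  "('x::metric_space \<Rightarrow> 'y::real_vector set) \<Rightarrow> 'y set \<Rightarrow> bool" where
  "lower_complete f K \<longleftrightarrow>
     (\<forall>x :: nat \<Rightarrow> 'x.
        Cauchy x \<and> (\<forall>n. f (x n) \<subseteq> f (x (Suc n)) + K) \<longrightarrow> (\<exists>xbar. x \<longlonglongrightarrow> xbar))"

end

theory Submission
  imports Defs
begin

text \<open>
  The proof is a greedy descent for the relation
  \<open>f x \<subseteq> f z + (\<gamma> \<cdot> dist x z) H + K\<close> between \<open>x\<close> and \<open>z \<in> S\<close>, read as ``\<open>z\<close> improves on \<open>x\<close> by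
  at least \<open>\<gamma>\<close> times the distance travelled''.

  The sets \<open>t H + K\<close> are superadditive in \<open>t\<close>: convexity of \<open>H + K\<close> gives
  \<open>(s H + K) + (t H + K) \<subseteq> (s + t) H + K\<close>.  They also shrink as \<open>t\<close> grows, since \<open>H \<subseteq> K\<close>.
  With the triangle inequality this makes the relation transitive; it also
  shows that along a chain the improvements add up, so a chain from \<open>x0\<close> to \<open>z\<close> of total length
  \<open>L\<close> gives \<open>f x0 \<subseteq> f z + \<gamma> L H + K\<close>.  Approximate efficiency of \<open>x0\<close> says that some
  \<open>y0 \<in> f x0\<close> lies in no set \<open>f z + \<epsilon> H + K\<close> with \<open>z \<in> S\<close>, whence \<open>\<gamma> L < \<epsilon>\<close>.  So all chains
  from \<open>x0\<close> have length at most \<open>\<epsilon> / \<gamma>\<close>.  In particular, every point reachable from \<open>x0\<close>,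
  that is, related to it, is within this distance.

  Now move each time at least half as far as possible (\<open>greedy_chain\<close>).  The bounded
  length forces the steps to \<open>0\<close>, hence also the radius of the set of points reachable from the
  \<open>n\<close>-th term.  The chain is therefore Cauchy.  Its limit is reachable from every term
  (\<open>limit_reachable\<close>: sequential lower monotonicity, and closedness in the direction
  \<open>v0\<close> to pass to the limit in the distance), and by transitivity so is anything reachable
  from the limit; as the radii vanish, only the limit itself is reachable from the limit.
\<close>

section \<open>Dilations of a set modulo a convex cone\<close>

text \<open>The value at \<open>t = 0\<close> is \<open>K\<close> (for nonempty \<open>H\<close>), whereas \<open>t (H + K)\<close> would collapse to
  \<open>{0}\<close>; for \<open>t > 0\<close> the two agree.\<close>

definition cone_dilation :: "'y::real_vector set \<Rightarrow> 'y set \<Rightarrow> real \<Rightarrow> 'y set" where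
  "cone_dilation K H t = (*\<^sub>R) t ` H + K"

lemma cone_dilation_iff:
  "y \<in> cone_dilation K H t \<longleftrightarrow> (\<exists>h\<in>H. \<exists>k\<in>K. y = t *\<^sub>R h + k)"
  by (auto simp: cone_dilation_def set_plus_def)

lemma pointed_convex_cone_imp_convex_cone:
  assumes "pointed_convex_cone K"
  shows "convex_cone K"
proof -
  have "x + y \<in> K" if "x \<in> K" "y \<in> K" for x y
    using assms set_plus_intro[OF that] by (auto simp: pointed_convex_cone_def)
  then show ?thesis
    using assms
    by (fastforce simp: pointed_convex_cone_def nontrivial_cone_def convex_cone_iff cone_def)
qed

lemma cone_dilation_zero:
  assumes "H \<noteq> {}"
  shows "cone_dilation K H 0 = K"
  using assms by (auto simp: cone_dilation_iff)

lemma cone_dilation_antimono: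
  assumes K: "convex_cone K" and H: "H \<subseteq> K" and st: "s \<le> t"
  shows "cone_dilation K H t \<subseteq> cone_dilation K H s"
proof
  fix y assume "y \<in> cone_dilation K H t"
  then obtain h k where hk: "h \<in> H" "k \<in> K" "y = t *\<^sub>R h + k"
    by (auto simp: cone_dilation_iff)
  have "y = s *\<^sub>R h + ((t - s) *\<^sub>R h + k)"
    by (simp add: hk algebra_simps)
  moreover have "(t - s) *\<^sub>R h + k \<in> K"
    using hk H st by (intro convex_cone_add[OF K] convex_cone_scaleR[OF K]) auto
  ultimately show "y \<in> cone_dilation K H s"
    using hk(1) by (auto simp: cone_dilation_iff)
qed

text \<open>This is where convexity of \<open>H + K\<close> enters: the point of \<open>H\<close> sought for
  \<open>s h\<^sub>1 + t h\<^sub>2\<close> is obtained from the convex combination with weights proportional to \<open>s\<close>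
  and \<open>t\<close>, which lies in \<open>H + K\<close> although perhaps not in \<open>H\<close>.\<close>

lemma cone_dilation_add:
  assumes K: "convex_cone K" and H: "cone_convex K H" and st: "0 \<le> s" "0 \<le> t"
    and y1: "y1 \<in> cone_dilation K H s" and y2: "y2 \<in> cone_dilation K H t"
  shows "y1 + y2 \<in> cone_dilation K H (s + t)"
proof -
  obtain h1 k1 where 1: "h1 \<in> H" "k1 \<in> K" "y1 = s *\<^sub>R h1 + k1"
    using y1 by (auto simp: cone_dilation_iff)
  obtain h2 k2 where 2: "h2 \<in> H" "k2 \<in> K" "y2 = t *\<^sub>R h2 + k2"
    using y2 by (auto simp: cone_dilation_iff)
  have k12: "k1 + k2 \<in> K"
    using 1 2 K by (blast intro: convex_cone_add)
  show ?thesis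
  proof (cases "s + t = 0")
    case True
    then have "s = 0" "t = 0"
      using st by auto
    then show ?thesis
      using 1 2 k12 by (auto simp: cone_dilation_iff)
  next
    case False
    then have pos: "s + t > 0"
      using st by simp
    have "0 \<in> K"
      using K by (rule convex_cone_contains_0)
    then have "h1 \<in> H + K" "h2 \<in> H + K"
      using 1(1) 2(1) by (metis add.right_neutral set_plus_intro)+
    moreover have "s / (s + t) + t / (s + t) = 1"
      using pos by (simp add: add_divide_distrib[symmetric])
    ultimately have "(s / (s + t)) *\<^sub>R h1 + (t / (s + t)) *\<^sub>R h2 \<in> H + K"
      using H pos st by (intro convexD) (auto simp: cone_convex_def)
    then obtain h k where hk: "h \<in> H" "k \<in> K"
      and comb: "(s / (s + t)) *\<^sub>R h1 + (t / (s + t)) *\<^sub>R h2 = h + k"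
      by (auto elim: set_plus_elim)
    have "s *\<^sub>R h1 + t *\<^sub>R h2 = (s + t) *\<^sub>R ((s / (s + t)) *\<^sub>R h1 + (t / (s + t)) *\<^sub>R h2)"
      using pos by (simp add: scaleR_add_right)
    also have "\<dots> = (s + t) *\<^sub>R h + (s + t) *\<^sub>R k"
      by (simp add: comb scaleR_add_right)
    finally have "y1 + y2 = (s + t) *\<^sub>R h + ((s + t) *\<^sub>R k + (k1 + k2))"
      by (simp add: 1 2 algebra_simps)
    moreover have "(s + t) *\<^sub>R k + (k1 + k2) \<in> K"
      using hk k12 pos by (intro convex_cone_add[OF K _ k12] convex_cone_scaleR[OF K]) auto
    ultimately show ?thesis
      using hk(1) by (auto simp: cone_dilation_iff)
  qed
qed

lemma cone_dilation_chain:
  assumes K: "convex_cone K" and H: "cone_convex K H" and st: "0 \<le> s" "0 \<le> t"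
    and AB: "A \<subseteq> B + cone_dilation K H s" and BC: "B \<subseteq> C + cone_dilation K H t"
  shows "A \<subseteq> C + cone_dilation K H (s + t)"
proof
  fix a assume "a \<in> A"
  then obtain b d where bd: "b \<in> B" "d \<in> cone_dilation K H s" "a = b + d"
    using AB by (auto elim!: set_plus_elim)
  then obtain c e where ce: "c \<in> C" "e \<in> cone_dilation K H t" "b = c + e"
    using BC by (auto elim!: set_plus_elim)
  have "d + e \<in> cone_dilation K H (s + t)"
    using K H st bd(2) ce(2) by (rule cone_dilation_add)
  moreover have "a = c + (d + e)"
    by (simp add: bd(3) ce(3) algebra_simps)
  ultimately show "a \<in> C + cone_dilation K H (s + t)"
    using ce(1) by auto
qed

text \<open>A deficit in the dilation parameter is made up by a small move along \<open>v0\<close>,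
  so directional closedness turns a limit of parameters into membership.\<close>

lemma dir_closed_cone_dilation_limit:
  assumes K: "convex_cone K" and H: "H \<subseteq> K" "cone_convex K H"
    and v0: "v0 \<in> H + K" and closed: "dir_closed v0 (A + cone_dilation K H t)"
    and s: "s \<longlonglongrightarrow> t" "\<And>m. 0 \<le> s m"
    and mem: "\<And>m. y \<in> A + cone_dilation K H (s m)"
  shows "y \<in> A + cone_dilation K H t"
proof -
  define l where "l = (\<lambda>m. max 0 (t - s m))"
  have l0: "0 \<le> l m" for m
    by (simp add: l_def)
  have "l \<longlonglongrightarrow> max 0 (t - t)"
    unfolding l_def by (intro tendsto_intros s(1))
  then have llim: "l \<longlonglongrightarrow> 0"
    by simp
  have "y + l m *\<^sub>R v0 \<in> A + cone_dilation K H t" for m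
  proof -
    obtain a d where ad: "a \<in> A" "d \<in> cone_dilation K H (s m)" "y = a + d"
      using mem[of m] by (auto elim: set_plus_elim)
    obtain h k where hk: "h \<in> H" "k \<in> K" "v0 = h + k"
      using v0 by (auto elim: set_plus_elim)
    have "l m *\<^sub>R v0 = l m *\<^sub>R h + l m *\<^sub>R k" "l m *\<^sub>R k \<in> K"
      using hk l0[of m] by (auto simp: scaleR_add_right intro: convex_cone_scaleR[OF K])
    then have "l m *\<^sub>R v0 \<in> cone_dilation K H (l m)"
      using hk(1) by (auto simp: cone_dilation_iff)
    then have "d + l m *\<^sub>R v0 \<in> cone_dilation K H (s m + l m)"
      using cone_dilation_add[OF K H(2) s(2) l0 ad(2)] by simp
    moreover have "t \<le> s m + l m"
      by (simp add: l_def)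
    ultimately have "d + l m *\<^sub>R v0 \<in> cone_dilation K H t"
      using cone_dilation_antimono[OF K H(1)] by blast
    then have "a + (d + l m *\<^sub>R v0) \<in> A + cone_dilation K H t"
      using ad(1) by auto
    then show ?thesis
      by (simp add: ad(3) add.assoc)
  qed
  then have "y \<in> vcl_dir v0 (A + cone_dilation K H t)"
    unfolding vcl_dir_def using l0 llim by blast
  then show ?thesis
    using closed by (simp add: dir_closed_def)
qed

section \<open>Greedy chains of bounded length\<close>

lemma chain_reachable:
  assumes sub: "\<And>x. R x \<subseteq> S" and refl: "\<And>x. x \<in> S \<Longrightarrow> x \<in> R x"
    and trans: "\<And>x y z. y \<in> R x \<Longrightarrow> z \<in> R y \<Longrightarrow> z \<in> R x"
    and u: "u 0 \<in> S" "\<And>n. u (Suc n) \<in> R (u n)" and nm: "n \<le> m"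
  shows "u m \<in> R (u n)"
  using nm
proof (induction m rule: dec_induct)
  case base
  have "u n \<in> S"
    using sub u by (cases n) auto
  then show ?case
    by (rule refl)
next
  case (step m)
  then show ?case
    using trans u(2) by blast
qed

text \<open>From each point move at least half as far as possible.  All the lengths along the chain
  are bounded together, so the steps tend to \<open>0\<close>, and by the choice
  of the steps everything reachable from the \<open>n\<close>-th term lies within twice the \<open>n\<close>-th step.\<close>

lemma greedy_chain:
  fixes R :: "'x::metric_space \<Rightarrow> 'x set"
  assumes sub: "\<And>x. R x \<subseteq> S" and refl: "\<And>x. x \<in> S \<Longrightarrow> x \<in> R x"
    and trans: "\<And>x y z. y \<in> R x \<Longrightarrow> z \<in> R y \<Longrightarrow> z \<in> R x"
    and x0: "x0 \<in> S"
    and bound: "\<And>u n. u 0 = x0 \<Longrightarrow> (\<And>n. u (Suc n) \<in> R (u n)) \<Longrightarrow>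
      (\<Sum>i<n. dist (u i) (u (Suc i))) \<le> B"
  obtains u r where "u 0 = x0" "\<And>n. u (Suc n) \<in> R (u n)" "Cauchy u"
    "r \<longlonglongrightarrow> 0" "\<And>n z. z \<in> R (u n) \<Longrightarrow> dist (u n) z \<le> r n"
proof -
  have radius: "dist x z \<le> B" if x: "x \<in> R x0" and z: "z \<in> R x" for x z
  proof -
    \<comment> \<open>The two moves, continued by resting at \<open>z\<close>, form a chain to which the bound applies.\<close>
    define w where "w = (\<lambda>n::nat. if n = 0 then x0 else if n = 1 then x else z)"
    have "z \<in> R z"
      using refl sub z by blast
    then have "w (Suc n) \<in> R (w n)" for n
      using x z by (auto simp: w_def)
    then have "(\<Sum>i<2. dist (w i) (w (Suc i))) \<le> B"
      by (intro bound) (auto simp: w_def)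
    then have "dist x0 x + dist x z \<le> B"
      by (simp add: w_def numeral_2_eq_2)
    then show ?thesis
      using zero_le_dist[of x0 x] by linarith
  qed
  have far: "\<exists>z\<in>R x. \<forall>w\<in>R x. dist x w \<le> 2 * dist x z" if x: "x \<in> R x0" for x
  proof -
    define M where "M = (SUP w\<in>R x. dist x w)"
    have xx: "x \<in> R x"
      using x sub refl by blast
    have bdd: "bdd_above (dist x ` R x)"
      using radius[OF x] by (intro bdd_aboveI2[where M = B]) auto
    have upper: "dist x w \<le> M" if "w \<in> R x" for w
      unfolding M_def using bdd that by (rule cSUP_upper2) simp
    show ?thesis
    proof (cases "M \<le> 0")
      case True
      then have "dist x w \<le> 2 * dist x x" if "w \<in> R x" for w
        using upper[OF that] True zero_le_dist[of x x] by linarith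
      then show ?thesis
        using xx by blast
    next
      case False
      then have "M / 2 < (SUP w\<in>R x. dist x w)"
        by (simp add: M_def)
      then obtain z where z: "z \<in> R x" "M / 2 < dist x z"
        using bdd xx by (subst (asm) less_cSUP_iff) auto
      then have "dist x w \<le> 2 * dist x z" if "w \<in> R x" for w
        using upper[OF that] by linarith
      then show ?thesis
        using z(1) by blast
    qed
  qed
  have "\<exists>u. \<forall>n. (u n \<in> R x0 \<and> (n = 0 \<longrightarrow> u n = x0)) \<and>
      (u (Suc n) \<in> R (u n) \<and> (\<forall>w\<in>R (u n). dist (u n) w \<le> 2 * dist (u n) (u (Suc n))))"
  proof (rule dependent_nat_choice)
    show "\<exists>x. x \<in> R x0 \<and> ((0::nat) = 0 \<longrightarrow> x = x0)"
      using refl x0 by blast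
  next
    fix x and n :: nat assume "x \<in> R x0 \<and> (n = 0 \<longrightarrow> x = x0)"
    then show "\<exists>y. (y \<in> R x0 \<and> (Suc n = 0 \<longrightarrow> y = x0)) \<and>
        y \<in> R x \<and> (\<forall>w\<in>R x. dist x w \<le> 2 * dist x y)"
      using far trans by blast
  qed
  then obtain u where u0: "u 0 = x0" and step: "\<And>n. u (Suc n) \<in> R (u n)"
    and greedy: "\<And>n w. w \<in> R (u n) \<Longrightarrow> dist (u n) w \<le> 2 * dist (u n) (u (Suc n))"
    by blast
  define r where "r = (\<lambda>n. 2 * dist (u n) (u (Suc n)))"
  have "(\<Sum>i\<le>n. dist (u i) (u (Suc i))) \<le> B" for n
    using bound[OF u0 step, of "Suc n"] by (simp only: lessThan_Suc_atMost)
  then have "summable (\<lambda>n. dist (u n) (u (Suc n)))"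
    by (intro bounded_imp_summable[where B = B]) auto
  then have r: "r \<longlonglongrightarrow> 0"
    unfolding r_def by (intro tendsto_mult_right_zero summable_LIMSEQ_zero)
  have "Cauchy u"
    unfolding Cauchy_altdef
  proof (intro allI impI)
    fix e :: real assume "e > 0"
    then obtain N where N: "\<And>n. n \<ge> N \<Longrightarrow> r n < e"
      using order_tendstoD(2)[OF r] by (auto simp: eventually_sequentially)
    have "dist (u m) (u n) < e" if "m \<ge> N" "n > m" for m n
    proof -
      have "u n \<in> R (u m)"
      proof (rule chain_reachable[of R S u])
        show "z \<in> R x" if "y \<in> R x" "z \<in> R y" for x y z
          using that by (rule trans)
        show "u 0 \<in> S"
          using x0 by (simp add: u0)
        show "m \<le> n"
          using that(2) by simp
      qed (use sub refl step in blast)+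
      then show ?thesis
        using greedy N[OF that(1)] by (fastforce simp: r_def)
    qed
    then show "\<exists>M. \<forall>m\<ge>M. \<forall>n>m. dist (u m) (u n) < e"
      by blast
  qed
  moreover have "dist (u n) z \<le> r n" if "z \<in> R (u n)" for n z
    using greedy[OF that] by (simp add: r_def)
  ultimately show thesis
    using u0 step r by (intro that[of u r])
qed

section \<open>The set-valued variational principle\<close>

text \<open>Lower monotonicity alone gives the inclusion with \<open>K\<close>, without any gain from the
  distance.  For a fixed start \<open>u n\<close> the gain up to \<open>u m\<close> can be put in front of it, and
  directional closedness then lets \<open>dist (u n) (u m)\<close> tend to \<open>dist (u n) xbar\<close>.\<close>

lemma limit_reachable:
  assumes K: "convex_cone K" and H: "H \<subseteq> K" "H \<noteq> {}" "cone_convex K H"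
    and slm: "K_slm K f" and v0: "v0 \<in> H + K"
    and closed: "KH_dir_closed_values K H v0 f" and \<gamma>: "0 \<le> \<gamma>"
    and lim: "u \<longlonglongrightarrow> xbar"
    and chain: "\<And>n m. n \<le> m \<Longrightarrow> f (u n) \<subseteq> f (u m) + cone_dilation K H (\<gamma> * dist (u n) (u m))"
  shows "f (u n) \<subseteq> f xbar + cone_dilation K H (\<gamma> * dist (u n) xbar)"
proof -
  have "cone_dilation K H (\<gamma> * dist (u n) (u m)) \<subseteq> K" for n m
    using cone_dilation_antimono[OF K H(1), of 0 "\<gamma> * dist (u n) (u m)"] \<gamma>
    by (simp add: cone_dilation_zero[OF H(2)])
  then have "f (u n) \<subseteq> f (u (Suc n)) + K" for n
    using chain[of n "Suc n"] set_plus_mono2[OF subset_refl] by (meson le_SucI order.trans order_refl)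
  then have lower: "f (u n) \<subseteq> f xbar + cone_dilation K H 0" for n
    using slm lim by (simp add: K_slm_def cone_dilation_zero[OF H(2)])
  \<comment> \<open>Closedness is available for positive dilation parameters only.\<close>
  show ?thesis
  proof (cases "\<gamma> * dist (u n) xbar = 0")
    case True
    show ?thesis
      unfolding True by (rule lower)
  next
    case False
    then have pos: "\<gamma> * dist (u n) xbar > 0"
      using \<gamma> by (simp add: less_le)
    have shifted: "(\<lambda>m. u (m + n)) \<longlonglongrightarrow> xbar"
      using lim by (rule LIMSEQ_ignore_initial_segment)
    show ?thesis
    proof
      fix y assume y: "y \<in> f (u n)"
      show "y \<in> f xbar + cone_dilation K H (\<gamma> * dist (u n) xbar)"
      proof (rule dir_closed_cone_dilation_limit[OF K H(1,3) v0])
        show "dir_closed v0 (f xbar + cone_dilation K H (\<gamma> * dist (u n) xbar))"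
          using closed pos by (simp add: KH_dir_closed_values_def cone_dilation_def add.assoc)
        show "(\<lambda>m. \<gamma> * dist (u n) (u (m + n))) \<longlonglongrightarrow> \<gamma> * dist (u n) xbar"
          by (intro tendsto_intros shifted)
        show "0 \<le> \<gamma> * dist (u n) (u (m + n))" for m
          using \<gamma> by simp
        show "y \<in> f xbar + cone_dilation K H (\<gamma> * dist (u n) (u (m + n)))" for m
        proof -
          have "f (u n) \<subseteq> f xbar + cone_dilation K H (\<gamma> * dist (u n) (u (m + n)) + 0)"
            using \<gamma> by (intro cone_dilation_chain[OF K H(3) _ _ chain lower]) auto
          then show ?thesis
            using y by auto
        qed
      qed
    qed
  qed
qed

text \<open>Since the dilations shrink, \<open>t \<ge> \<epsilon>\<close> would put the efficient value \<open>y0\<close> into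
  \<open>f z + \<epsilon> H + K\<close>, which is what efficiency excludes.\<close>

lemma nemeth_efficient_dilation_less:
  assumes K: "convex_cone K" and H: "H \<subseteq> K"
    and eff: "x0 \<in> nemeth_efficient f S K H \<epsilon>"
    and z: "z \<in> S" and sub: "f x0 \<subseteq> f z + cone_dilation K H t"
  shows "t < \<epsilon>"
proof (rule ccontr)
  assume "\<not> t < \<epsilon>"
  then have anti: "cone_dilation K H t \<subseteq> cone_dilation K H \<epsilon>"
    by (intro cone_dilation_antimono[OF K H]) simp
  obtain y0 where y0: "y0 \<in> f x0"
    and disj: "(\<lambda>y. y - y0) ` (\<Union>x\<in>S. f x) \<inter> ((*\<^sub>R) (- \<epsilon>) ` H + uminus ` K) = {}"
    using eff by (auto simp: nemeth_efficient_def)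
  obtain y d where yd: "y \<in> f z" "d \<in> cone_dilation K H t" "y0 = y + d"
    using y0 sub by (auto elim!: set_plus_elim)
  then have "d \<in> cone_dilation K H \<epsilon>"
    using anti by blast
  then obtain h k where hk: "h \<in> H" "k \<in> K" "d = \<epsilon> *\<^sub>R h + k"
    unfolding cone_dilation_iff by blast
  have "y - y0 = (- \<epsilon>) *\<^sub>R h + - k"
    by (simp add: yd(3) hk(3))
  then have "y - y0 \<in> (*\<^sub>R) (- \<epsilon>) ` H + uminus ` K"
    using hk(1,2) by (metis image_eqI set_plus_intro)
  moreover have "y - y0 \<in> (\<lambda>y. y - y0) ` (\<Union>x\<in>S. f x)"
    using yd(1) z by blast
  ultimately show False
    using disj by blast
qed

theorem theorem6p7:
  fixes f :: "'x::metric_space \<Rightarrow> 'y::real_vector set"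
    and K H :: "'y set" and v0 :: 'y
    and S :: "'x set" and x0 :: 'x and \<epsilon> \<gamma> :: real
  assumes K: "pointed_convex_cone K"
    and H: "H \<subseteq> K" "H \<noteq> {}" "cone_convex K H" "0 \<notin> vcl (H + K)"
    and S: "S \<noteq> {}" "closed S" "x0 \<in> S"
    and pos: "\<epsilon> > 0" "\<gamma> > 0"
    and i: "lower_complete f K \<or> complete (UNIV :: 'x set)"
    and ii: "x0 \<in> nemeth_efficient f S K H \<epsilon>"
    and iii: "K_slm K f" "v0 \<in> H + K" "KH_dir_closed_values K H v0 f"
  shows "\<exists>xbar\<in>S.
    f x0 \<subseteq> f xbar + (*\<^sub>R) (\<gamma> * dist x0 xbar) ` H + K \<and>
    (\<forall>x\<in>S - {xbar}. \<not> f xbar \<subseteq> f x + (*\<^sub>R) (\<gamma> * dist xbar x) ` H + K) \<and>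
    dist x0 xbar \<le> \<epsilon> / \<gamma>"
proof -
  note K' = pointed_convex_cone_imp_convex_cone[OF K]
  define D where "D = cone_dilation K H"
  define R where "R = (\<lambda>x. {z \<in> S. f x \<subseteq> f z + D (\<gamma> * dist x z)})"
  have sub: "R x \<subseteq> S" for x
    by (auto simp: R_def)
  have D0: "D 0 = K"
    by (simp add: D_def cone_dilation_zero[OF H(2)])
  have refl: "x \<in> R x" if "x \<in> S" for x
    using that set_zero_plus2[OF convex_cone_contains_0[OF K'], of "f x"]
    by (simp add: R_def D0 add.commute)
  have anti: "A + D t \<subseteq> A + D s" if "s \<le> t" for s t A
    using cone_dilation_antimono[OF K' H(1) that] unfolding D_def
    by (intro set_plus_mono2) auto
  have trans: "z \<in> R x" if y: "y \<in> R x" and z: "z \<in> R y" for x y z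
  proof -
    have "f x \<subseteq> f z + D (\<gamma> * dist x y + \<gamma> * dist y z)"
      using y z pos(2) unfolding D_def R_def by (intro cone_dilation_chain[OF K' H(3)]) auto
    moreover have "\<gamma> * dist x z \<le> \<gamma> * dist x y + \<gamma> * dist y z"
      using pos(2) dist_triangle[of x z y] by (simp flip: distrib_left)
    ultimately show ?thesis
      using z anti unfolding R_def by blast
  qed
  have bound: "(\<Sum>i<n. dist (u i) (u (Suc i))) \<le> \<epsilon> / \<gamma>"
    if u: "u 0 = x0" "\<And>n. u (Suc n) \<in> R (u n)" for u n
  proof -
    have "u n \<in> S"
      using u S(3) sub by (cases n) auto
    moreover have "f x0 \<subseteq> f (u n) + D (\<gamma> * (\<Sum>i<n. dist (u i) (u (Suc i))))"
    proof (induction n)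
      case 0
      then show ?case
        using refl[OF S(3)] by (simp add: R_def u(1))
    next
      case (Suc n)
      have "f (u n) \<subseteq> f (u (Suc n)) + D (\<gamma> * dist (u n) (u (Suc n)))"
        using u(2)[of n] by (simp add: R_def)
      with Suc have "f x0 \<subseteq> f (u (Suc n)) +
          D (\<gamma> * (\<Sum>i<n. dist (u i) (u (Suc i))) + \<gamma> * dist (u n) (u (Suc n)))"
        using pos(2) unfolding D_def
        by (intro cone_dilation_chain[OF K' H(3)]) (auto intro!: mult_nonneg_nonneg sum_nonneg)
      then show ?case
        by (simp add: distrib_left)
    qed
    ultimately have "\<gamma> * (\<Sum>i<n. dist (u i) (u (Suc i))) < \<epsilon>"
      unfolding D_def by (rule nemeth_efficient_dilation_less[OF K' H(1) ii])
    then show ?thesis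
      using pos(2) by (simp add: field_simps)
  qed
  have "\<exists>u r. u 0 = x0 \<and> (\<forall>n. u (Suc n) \<in> R (u n)) \<and> Cauchy u \<and> r \<longlonglongrightarrow> 0 \<and>
      (\<forall>n. \<forall>z\<in>R (u n). dist (u n) z \<le> r n)"
  proof (rule greedy_chain[of R S x0 "\<epsilon> / \<gamma>"])
    show "z \<in> R x" if "y \<in> R x" "z \<in> R y" for x y z
      using that by (rule trans)
    show "(\<Sum>i<n. dist (u i) (u (Suc i))) \<le> \<epsilon> / \<gamma>"
      if "u 0 = x0" "\<And>n. u (Suc n) \<in> R (u n)" for u n
      using that by (rule bound)
  qed (use sub refl S(3) in blast)+
  then obtain u r where u0: "u 0 = x0" and step: "\<And>n. u (Suc n) \<in> R (u n)"
    and cau: "Cauchy u" and r: "r \<longlonglongrightarrow> 0"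
    and radius: "\<And>n z. z \<in> R (u n) \<Longrightarrow> dist (u n) z \<le> r n"
    by blast
  have uS: "u n \<in> S" for n
    using sub step S(3) by (cases n) (auto simp: u0)
  have later: "u m \<in> R (u n)" if "n \<le> m" for n m
  proof (rule chain_reachable[of R S u])
    show "z \<in> R x" if "y \<in> R x" "z \<in> R y" for x y z
      using that by (rule trans)
  qed (use sub refl step uS that in blast)+
  have "f (u n) \<subseteq> f (u (Suc n)) + K" for n
    using step[of n] anti[of 0 "\<gamma> * dist (u n) (u (Suc n))"] pos(2)
    by (force simp: R_def D0)
  then obtain xbar where lim: "u \<longlonglongrightarrow> xbar"
    using i cau unfolding lower_complete_def complete_def by blast
  have xS: "xbar \<in> S"
    using S(2) uS lim by (rule closed_sequentially)
  have limR: "xbar \<in> R (u n)" for n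
    using limit_reachable[OF K' H(1-3) iii _ lim, of \<gamma> n] later pos(2) xS
    by (auto simp: R_def D_def)
  have final: "x = xbar" if x: "x \<in> R xbar" for x
  proof -
    have "dist (u n) x \<le> r n" for n
      using limR x trans radius by blast
    then have "(\<lambda>n. dist (u n) x) \<longlonglongrightarrow> 0"
      by (intro tendsto_sandwich[OF _ _ tendsto_const r]) (simp_all add: always_eventually)
    then have "u \<longlonglongrightarrow> x"
      by (rule tendsto_dist_iff[THEN iffD2])
    then show ?thesis
      using lim by (rule LIMSEQ_unique)
  qed
  have xR: "xbar \<in> R x0"
    using limR[of 0] by (simp add: u0)
  have "\<gamma> * dist x0 xbar < \<epsilon>"
    using nemeth_efficient_dilation_less[OF K' H(1) ii xS] xR by (simp add: R_def D_def)
  then have "dist x0 xbar \<le> \<epsilon> / \<gamma>"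
    using pos(2) by (simp add: field_simps)
  moreover have "f x0 \<subseteq> f xbar + (*\<^sub>R) (\<gamma> * dist x0 xbar) ` H + K"
    using xR by (simp add: R_def D_def cone_dilation_def add.assoc)
  moreover have "\<forall>x\<in>S - {xbar}. \<not> f xbar \<subseteq> f x + (*\<^sub>R) (\<gamma> * dist xbar x) ` H + K"
    using final by (auto simp: R_def D_def cone_dilation_def add.assoc)
  ultimately show ?thesis
    using xS by blast
qed

end
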